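(* Let $N,M\ge 1$ be integers, $\sigma>0$ and $|\rho|<1$ real. Let $x_{0n},y_{0n}$ ($1\le n\le N$) and $x_{mn},y_{mn}$ ($2\le m\le M$, $1\le n\le N$) be mutually independent real Gaussian random variables with mean $0$ and variance $1/2$. Define $h_{1n}=\sigma x_{0n}+j\sigma y_{0n}$ and, for $2\le m\le M$, $h_{mn}=\sigma(\sqrt{1-\rho^2}\,x_{mn}+\rho x_{0n})+j\sigma(\sqrt{1-\rho^2}\,y_{mn}+\rho y_{0n})$, where $j$ is the imaginary unit. Let $X_m=\sum_{n=1}^N|h_{mn}|^2$, $X_{\rm FAS}=\max\{X_1,\dots,X_M\}$ and $P_{\rm out}(\gamma_{th})=\Pr(X_{\rm FAS}<\gamma_{th})$. Then for every $\gamma_{th}>0$, $$P_{\rm out}(\gamma_{th})\le\frac{1}{(N-1)!}\,\gamma\!\left(N,\frac{\gamma_{th}}{\sigma^2}\right)\left(1-e^{-\frac{2\gamma_{th}}{\sigma^2(1-\rho^2)}}\right)^{M-1}.$$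
   Context: $\gamma(N,x)=\int_0^x s^{N-1}e^{-s}\,ds$ is the lower incomplete gamma function. *)

theory Defs
  imports "HOL-Probability.Probability"
begin

definition lower_incomplete_gamma :: "nat \<Rightarrow> real \<Rightarrow> real" where
  "lower_incomplete_gamma N x = integral {0..x} (\<lambda>s. s ^ (N - 1) * exp (- s))"

text \<open>
  The Gaussian variables are given by two families \<open>x m n\<close> and \<open>y m n\<close>, of which only the
  indices below are used: \<open>m = 0\<close> is the component shared by all ports, and there are no
  variables with \<open>m = 1\<close>.
\<close>

definition gauss_indices :: "nat \<Rightarrow> nat \<Rightarrow> (nat \<times> nat) set" where
  "gauss_indices M N = ({0} \<union> {2..M}) \<times> {1..N}"

text \<open>
  The disjoint sum of the two index sets makes all the \<open>x m n\<close> and all the \<open>y m n\<close>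
  \<^emph>\<open>jointly\<close> independent.
\<close>

definition iid_gaussians ::
    "'a measure \<Rightarrow> nat \<Rightarrow> nat \<Rightarrow> (nat \<Rightarrow> nat \<Rightarrow> 'a \<Rightarrow> real) \<Rightarrow> (nat \<Rightarrow> nat \<Rightarrow> 'a \<Rightarrow> real) \<Rightarrow> bool" where
  "iid_gaussians P M N x y \<longleftrightarrow>
     (\<forall>(m, n) \<in> gauss_indices M N.
        distributed P lborel (x m n) (normal_density 0 (sqrt (1 / 2))) \<and>
        distributed P lborel (y m n) (normal_density 0 (sqrt (1 / 2)))) \<and>
     prob_space.indep_vars P (\<lambda>_. borel)
       (case_sum (\<lambda>(m, n). x m n) (\<lambda>(m, n). y m n))
       (gauss_indices M N <+> gauss_indices M N)"

definition channel ::
    "real \<Rightarrow> real \<Rightarrow> (nat \<Rightarrow> nat \<Rightarrow> 'a \<Rightarrow> real) \<Rightarrow> (nat \<Rightarrow> nat \<Rightarrow> 'a \<Rightarrow> real) \<Rightarrow>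
     nat \<Rightarrow> nat \<Rightarrow> 'a \<Rightarrow> complex" where
  "channel \<sigma> \<rho> x y m n \<omega> =
     (if m = 1
      then complex_of_real (\<sigma> * x 0 n \<omega>) + \<i> * complex_of_real (\<sigma> * y 0 n \<omega>)
      else complex_of_real (\<sigma> * (sqrt (1 - \<rho>\<^sup>2) * x m n \<omega> + \<rho> * x 0 n \<omega>))
         + \<i> * complex_of_real (\<sigma> * (sqrt (1 - \<rho>\<^sup>2) * y m n \<omega> + \<rho> * y 0 n \<omega>)))"

definition port_gain ::
    "real \<Rightarrow> real \<Rightarrow> nat \<Rightarrow> (nat \<Rightarrow> nat \<Rightarrow> 'a \<Rightarrow> real) \<Rightarrow> (nat \<Rightarrow> nat \<Rightarrow> 'a \<Rightarrow> real) \<Rightarrow>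
     nat \<Rightarrow> 'a \<Rightarrow> real" where
  "port_gain \<sigma> \<rho> N x y m \<omega> = (\<Sum>n=1..N. (cmod (channel \<sigma> \<rho> x y m n \<omega>))\<^sup>2)"

definition X_FAS ::
    "real \<Rightarrow> real \<Rightarrow> nat \<Rightarrow> nat \<Rightarrow> (nat \<Rightarrow> nat \<Rightarrow> 'a \<Rightarrow> real) \<Rightarrow> (nat \<Rightarrow> nat \<Rightarrow> 'a \<Rightarrow> real) \<Rightarrow>
     'a \<Rightarrow> real" where
  "X_FAS \<sigma> \<rho> M N x y \<omega> = Max ((\<lambda>m. port_gain \<sigma> \<rho> N x y m \<omega>) ` {1..M})"

definition P_out ::
    "'a measure \<Rightarrow> real \<Rightarrow> real \<Rightarrow> nat \<Rightarrow> nat \<Rightarrow> (nat \<Rightarrow> nat \<Rightarrow> 'a \<Rightarrow> real) \<Rightarrow>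
     (nat \<Rightarrow> nat \<Rightarrow> 'a \<Rightarrow> real) \<Rightarrow> real \<Rightarrow> real" where
  "P_out P \<sigma> \<rho> M N x y \<gamma> = measure P {\<omega> \<in> space P. X_FAS \<sigma> \<rho> M N x y \<omega> < \<gamma>}"

end

theory Submission
  imports Defs
begin

text \<open>
  Condition on the shared components \<open>x\<^sub>0\<^sub>n, y\<^sub>0\<^sub>n\<close>, whose squares sum to an Erlang variable: this gives the
  incomplete gamma factor. For each port \<open>m \<ge> 2\<close> only the antenna \<open>n = 1\<close> is kept. The event
  \<open>X\<^sub>m < \<gamma>\<close> forces the real and the imaginary part of \<open>h\<^sub>m\<^sub>1\<close> to lie in intervals of half-width
  \<open>sqrt \<gamma>\<close>; centring these intervals at the mean only increases their Gaussian probability, and the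
  square \<open>\<bar>x\<bar>, \<bar>y\<bar> < t\<close> with \<open>t\<^sup>2 = \<gamma> / (\<sigma>\<^sup>2 (1 - \<rho>\<^sup>2))\<close> lies in the disc \<open>x\<^sup>2 + y\<^sup>2 \<le> 2 t\<^sup>2\<close>, of probability
  \<open>1 - exp (- 2 t\<^sup>2)\<close>. This is where the factor 2 in the exponent comes from.
\<close>

section \<open>Gaussian probability of a shifted interval\<close>

text \<open>
  The two differences of the intervals have equal length, and \<open>f\<close> is at most \<open>f t\<close> on one of them
  and at least \<open>f t\<close> on the other.
\<close>
lemma nn_integral_shifted_interval_le:
  fixes f :: "real \<Rightarrow> ennreal"
  assumes [measurable]: "f \<in> borel_measurable borel"
    and decr: "\<And>x y. \<bar>x\<bar> \<le> \<bar>y\<bar> \<Longrightarrow> f y \<le> f x"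
  shows "(\<integral>\<^sup>+x. f x * indicator {x. \<bar>x + c\<bar> < t} x \<partial>lborel)
       \<le> (\<integral>\<^sup>+x. f x * indicator {x. \<bar>x\<bar> < t} x \<partial>lborel)"
proof -
  define A where "A = {x::real. \<bar>x + c\<bar> < t}"
  define B where "B = {x::real. \<bar>x\<bar> < t}"
  have A: "A = {- c - t <..< - c + t}" and B: "B = {- t <..< t}"
    by (auto simp: A_def B_def)
  have [measurable]: "A \<in> sets borel" "B \<in> sets borel"
    by (simp_all add: A B)
  \<comment> \<open>For negative \<open>t\<close> both intervals are empty and
    \<open>ennreal (2 * t)\<close> truncates to 0, so one formula serves both cases.\<close>
  have em: "emeasure lborel A = ennreal (2 * t)" "emeasure lborel B = ennreal (2 * t)"
    by (cases "0 \<le> t"; simp add: A B ennreal_neg)+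
  \<comment> \<open>Finiteness of the overlap is what allows it to be cancelled in
    \<open>ennreal\<close> to get \<open>eq\<close>.\<close>
  have fin: "emeasure lborel (A \<inter> B) \<noteq> \<infinity>"
    using emeasure_mono[of "A \<inter> B" B lborel] by (auto simp: em top_unique)
  have "emeasure lborel (A - B) + emeasure lborel (A \<inter> B) = emeasure lborel A"
    by (subst plus_emeasure) (auto intro!: arg_cong[where f = "emeasure lborel"])
  also have "\<dots> = emeasure lborel B"
    by (simp add: em)
  also have "\<dots> = emeasure lborel (B - A) + emeasure lborel (A \<inter> B)"
    by (subst plus_emeasure) (auto intro!: arg_cong[where f = "emeasure lborel"])
  finally have eq: "emeasure lborel (A - B) = emeasure lborel (B - A)"
    using fin by (metis add.commute ennreal_add_left_cancel infinity_ennreal_def)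
  have "(\<integral>\<^sup>+x. f x * indicator (A - B) x \<partial>lborel) \<le> (\<integral>\<^sup>+x. f t * indicator (A - B) x \<partial>lborel)"
    by (intro nn_integral_mono) (auto simp: A_def B_def indicator_def intro!: decr)
  also have "\<dots> = (\<integral>\<^sup>+x. f t * indicator (B - A) x \<partial>lborel)"
    by (simp add: nn_integral_cmult eq)
  also have "\<dots> \<le> (\<integral>\<^sup>+x. f x * indicator (B - A) x \<partial>lborel)"
    by (intro nn_integral_mono) (auto simp: A_def B_def indicator_def intro!: decr)
  finally have le: "(\<integral>\<^sup>+x. f x * indicator (A - B) x \<partial>lborel)
      \<le> (\<integral>\<^sup>+x. f x * indicator (B - A) x \<partial>lborel)" .
  have "(\<integral>\<^sup>+x. f x * indicator A x \<partial>lborel)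
      = (\<integral>\<^sup>+x. f x * indicator (A - B) x \<partial>lborel) + (\<integral>\<^sup>+x. f x * indicator (A \<inter> B) x \<partial>lborel)"
    by (subst nn_integral_add[symmetric]) (auto intro!: nn_integral_cong simp: indicator_def)
  also have "\<dots> \<le> (\<integral>\<^sup>+x. f x * indicator (B - A) x \<partial>lborel) + (\<integral>\<^sup>+x. f x * indicator (A \<inter> B) x \<partial>lborel)"
    by (intro add_right_mono le)
  also have "\<dots> = (\<integral>\<^sup>+x. f x * indicator B x \<partial>lborel)"
    by (subst nn_integral_add[symmetric]) (auto intro!: nn_integral_cong simp: indicator_def)
  finally show ?thesis
    by (simp add: A_def B_def)
qed

text \<open>The centred normal density decreases in the absolute value of its argument, so the
  rearrangement bound above applies to it.\<close>

lemma (in prob_space) normal_prob_shifted_interval_le: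
  assumes X: "distributed M lborel X (normal_density 0 s)" and "s > 0"
  shows "prob {\<omega> \<in> space M. \<bar>X \<omega> + c\<bar> < t} \<le> prob {\<omega> \<in> space M. \<bar>X \<omega>\<bar> < t}"
proof -
  have eq: "emeasure M {\<omega> \<in> space M. \<bar>X \<omega> + a\<bar> < t}
      = (\<integral>\<^sup>+x. ennreal (normal_density 0 s x) * indicator {x. \<bar>x + a\<bar> < t} x \<partial>lborel)" for a
    by (subst distributed_emeasure[OF X, symmetric])
       (auto intro!: arg_cong[where f = "emeasure M"])
  have le: "(\<integral>\<^sup>+x. ennreal (normal_density 0 s x) * indicator {x. \<bar>x + c\<bar> < t} x \<partial>lborel)
      \<le> (\<integral>\<^sup>+x. ennreal (normal_density 0 s x) * indicator {x. \<bar>x\<bar> < t} x \<partial>lborel)"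
  proof (rule nn_integral_shifted_interval_le)
    fix x y :: real
    assume "\<bar>x\<bar> \<le> \<bar>y\<bar>"
    then have "x\<^sup>2 \<le> y\<^sup>2"
      by (simp add: abs_le_square_iff)
    then show "ennreal (normal_density 0 s y) \<le> ennreal (normal_density 0 s x)"
      using \<open>s > 0\<close> by (intro ennreal_leI) (auto simp: normal_density_def field_simps)
  qed simp
  have "emeasure M {\<omega> \<in> space M. \<bar>X \<omega> + c\<bar> < t} \<le> emeasure M {\<omega> \<in> space M. \<bar>X \<omega>\<bar> < t}"
    unfolding eq[of c] eq[of 0, unfolded add_0_right] by (rule le)
  then show ?thesis
    by (simp add: emeasure_eq_measure)
qed

section \<open>Squared modulus of a complex Gaussian\<close>

text \<open>
  Writing \<open>exp (- (norm z)\<^sup>2)\<close> as the integral of \<open>exp (- u)\<close> over \<open>u \<ge> (norm z)\<^sup>2\<close> and exchanging the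
  integrals reduces polar coordinates to the area of a disc.
\<close>
lemma nn_integral_exp_neg_norm_sq:
  assumes "0 \<le> a"
  shows "(\<integral>\<^sup>+z. ennreal (exp (- (norm z)\<^sup>2)) * indicator {z. (norm z)\<^sup>2 \<le> a} z \<partial>(lborel :: (real \<times> real) measure))
       = ennreal (pi * (1 - exp (- a)))"
proof -
  let ?q = "\<lambda>z :: real \<times> real. (norm z)\<^sup>2"
  have tail: "(\<integral>\<^sup>+u. ennreal (exp (- u)) * indicator {b..} u \<partial>lborel) = ennreal (exp (- b))" for b :: real
  proof -
    have "(\<integral>\<^sup>+u. ennreal (exp (- u)) * indicator {b..} u \<partial>lborel) = ennreal (0 - (- exp (- b)))"
    proof (rule nn_integral_FTC_atLeast)
      show "((\<lambda>u::real. - exp (- u)) \<longlongrightarrow> 0) at_top"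
        using tendsto_minus[OF filterlim_compose[OF exp_at_bot filterlim_uminus_at_bot_at_top]] by simp
    qed (auto intro!: derivative_eq_intros)
    then show ?thesis by simp
  qed
  have disc: "emeasure lborel {z. ?q z \<le> u} = ennreal (pi * u)" if "0 \<le> u" for u
  proof -
    have "{z. ?q z \<le> u} = cball 0 (sqrt u)"
      using that real_sqrt_le_iff[of "?q z" u for z] by auto
    then show ?thesis
      using that by (simp add: emeasure_cball unit_ball_vol_2)
  qed
  have "(\<integral>\<^sup>+z. ennreal (exp (- ?q z)) * indicator {z. ?q z \<le> a} z \<partial>lborel)
      = (\<integral>\<^sup>+z. (\<integral>\<^sup>+u. ennreal (exp (- u)) * (indicator {z. ?q z \<le> a} z * indicator {?q z..} u) \<partial>lborel) \<partial>lborel)"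
  proof (rule nn_integral_cong)
    fix z :: "real \<times> real"
    show "ennreal (exp (- ?q z)) * indicator {z. ?q z \<le> a} z
        = (\<integral>\<^sup>+u. ennreal (exp (- u)) * (indicator {z. ?q z \<le> a} z * indicator {?q z..} u) \<partial>lborel)"
      by (cases "?q z \<le> a") (simp_all add: tail)
  qed
  also have "\<dots> = (\<integral>\<^sup>+u. (\<integral>\<^sup>+z. ennreal (exp (- u)) * (indicator {z. ?q z \<le> a} z * indicator {?q z..} u) \<partial>lborel) \<partial>lborel)"
    by (rule lborel_pair.Fubini') (simp add: indicator_def[abs_def] split_beta')
  \<comment> \<open>For fixed \<open>u\<close> the inner integral is the area of the disc of squared
    radius \<open>min u a\<close>: it grows like \<open>pi * u\<close> up to \<open>a\<close> and
    stays at \<open>pi * a\<close> afterwards. At \<open>u = a\<close> both indicators are 1 and the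
    sum counts twice, so equality is claimed only almost everywhere.\<close>
  also have "\<dots> = (\<integral>\<^sup>+u. (ennreal (pi * (u * exp (- u))) * indicator {0..a} u
        + ennreal (pi * a) * (ennreal (exp (- u)) * indicator {a..} u)) \<partial>lborel)"
  proof (intro nn_integral_cong_AE)
    have "AE u in lborel. u \<noteq> a" by (rule AE_lborel_singleton)
    then show "AE u in lborel.
        (\<integral>\<^sup>+z. ennreal (exp (- u)) * (indicator {z. ?q z \<le> a} z * indicator {?q z..} u) \<partial>lborel)
      = ennreal (pi * (u * exp (- u))) * indicator {0..a} u
        + ennreal (pi * a) * (ennreal (exp (- u)) * indicator {a..} u)"
    proof eventually_elim
      case (elim u)
      have "(\<integral>\<^sup>+z. ennreal (exp (- u)) * (indicator {z. ?q z \<le> a} z * indicator {?q z..} u) \<partial>lborel)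
          = (\<integral>\<^sup>+z. ennreal (exp (- u)) * indicator {z. ?q z \<le> min u a} z \<partial>lborel)"
        by (intro nn_integral_cong) (auto simp: indicator_def)
      also have "\<dots> = ennreal (exp (- u)) * emeasure lborel {z. ?q z \<le> min u a}"
        by (simp add: nn_integral_cmult)
      also have "\<dots> = ennreal (pi * (u * exp (- u))) * indicator {0..a} u
        + ennreal (pi * a) * (ennreal (exp (- u)) * indicator {a..} u)"
      proof (cases "0 \<le> u")
        case True
        then show ?thesis
          using elim \<open>0 \<le> a\<close>
          by (subst disc) (auto simp: indicator_def min_def ennreal_mult'[symmetric] mult_ac)
      next
        case False
        then have "{z. ?q z \<le> min u a} = {}"
          by (auto simp: not_le) (smt (verit) zero_le_power2)
        then show ?thesis
          using False \<open>0 \<le> a\<close> by (simp only:) (simp add: indicator_def)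
      qed
      finally show ?case .
    qed
  qed
  also have "\<dots> = (\<integral>\<^sup>+u. ennreal (pi * (u * exp (- u))) * indicator {0..a} u \<partial>lborel)
        + ennreal (pi * a) * ennreal (exp (- a))"
    by (subst nn_integral_add) (auto simp: nn_integral_cmult tail)
  \<comment> \<open>The antiderivative of \<open>pi * (u * exp (- u))\<close> used here is
    \<open>- pi * (u + 1) * exp (- u)\<close>.\<close>
  also have "(\<integral>\<^sup>+u. ennreal (pi * (u * exp (- u))) * indicator {0..a} u \<partial>lborel)
      = ennreal (- pi * (a + 1) * exp (- a) - (- pi * (0 + 1) * exp (- 0)))"
    using \<open>0 \<le> a\<close>
    by (intro nn_integral_FTC_Icc) (auto intro!: derivative_eq_intros simp: algebra_simps)
  also have "\<dots> + ennreal (pi * a) * ennreal (exp (- a)) = ennreal (pi * (1 - exp (- a)))"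
  proof -
    \<comment> \<open>This makes the first summand nonnegative, without which \<open>ennreal\<close>
      would truncate it before the addition.\<close>
    have "(a + 1) * exp (- a) \<le> 1"
      using exp_ge_add_one_self[of a] by (simp add: exp_minus field_simps)
    then have "0 \<le> pi * (1 - (a + 1) * exp (- a))"
      by simp
    then have "0 \<le> - pi * (a + 1) * exp (- a) - (- pi * (0 + 1) * exp (- 0))"
      by (simp add: algebra_simps)
    then show ?thesis
      using \<open>0 \<le> a\<close>
      by (subst ennreal_mult'[symmetric], simp, subst ennreal_plus[symmetric])
         (auto simp: algebra_simps)
  qed
  finally show ?thesis .
qed

text \<open>With variance 1/2 the joint density is \<open>exp (- (norm z)\<^sup>2) / pi\<close>, so
  the disc integral above gives the distribution function \<open>1 - exp (- a)\<close>.\<close>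

lemma (in prob_space) sum_squares_normal_exponential:
  assumes X: "distributed M lborel X (normal_density 0 (sqrt (1 / 2)))"
    and Y: "distributed M lborel Y (normal_density 0 (sqrt (1 / 2)))"
    and indep: "indep_var borel X borel Y"
  shows "distributed M lborel (\<lambda>\<omega>. (X \<omega>)\<^sup>2 + (Y \<omega>)\<^sup>2) (exponential_density 1)"
proof (rule exponential_distributedI)
  have [measurable]: "X \<in> borel_measurable M" "Y \<in> borel_measurable M"
    using distributed_measurable[OF X] distributed_measurable[OF Y] by simp_all
  show "(\<lambda>\<omega>. (X \<omega>)\<^sup>2 + (Y \<omega>)\<^sup>2) \<in> borel_measurable M"
    by measurable
  \<comment> \<open>The densities are taken with respect to \<open>lborel\<close>, so independence
    is restated over \<open>lborel\<close>, which has the same measurable sets as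
    \<open>borel\<close>.\<close>
  have "indep_var lborel X lborel Y"
    using indep_var_compose[OF indep, of id lborel id lborel] by simp
  then have XY: "distributed M (lborel \<Otimes>\<^sub>M lborel) (\<lambda>\<omega>. (X \<omega>, Y \<omega>))
      (\<lambda>(x, y). ennreal (normal_density 0 (sqrt (1 / 2)) x) * ennreal (normal_density 0 (sqrt (1 / 2)) y))"
    by (intro distributed_joint_indep X Y) (auto intro: lborel.sigma_finite_measure_axioms)
  fix a :: real
  assume "0 \<le> a"
  have "emeasure M {\<omega> \<in> space M. (X \<omega>)\<^sup>2 + (Y \<omega>)\<^sup>2 \<le> a}
      = emeasure M ((\<lambda>\<omega>. (X \<omega>, Y \<omega>)) -` {z. (norm z)\<^sup>2 \<le> a} \<inter> space M)"
    by (intro arg_cong[where f = "emeasure M"]) (auto simp: norm_Pair)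
  also have "\<dots> = (\<integral>\<^sup>+z. (case z of (x, y) \<Rightarrow> ennreal (normal_density 0 (sqrt (1 / 2)) x)
      * ennreal (normal_density 0 (sqrt (1 / 2)) y)) * indicator {z. (norm z)\<^sup>2 \<le> a} z \<partial>(lborel \<Otimes>\<^sub>M lborel))"
    by (intro distributed_emeasure[OF XY]) (simp only: lborel_prod, simp)
  also have "\<dots> = (\<integral>\<^sup>+z. ennreal (1 / pi) * (ennreal (exp (- (norm z)\<^sup>2)) * indicator {z. (norm z)\<^sup>2 \<le> a} z) \<partial>(lborel :: (real \<times> real) measure))"
    unfolding lborel_prod
  proof (rule nn_integral_cong)
    fix z :: "real \<times> real"
    obtain u v where z: "z = (u, v)" by fastforce
    have "normal_density 0 (sqrt (1 / 2)) w = exp (- w\<^sup>2) / sqrt pi" for w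
      by (simp add: normal_density_def)
    then have "normal_density 0 (sqrt (1 / 2)) u * normal_density 0 (sqrt (1 / 2)) v = 1 / pi * exp (- (norm z)\<^sup>2)"
      by (simp add: z norm_Pair exp_add[symmetric])
    then show "(case z of (x, y) \<Rightarrow> ennreal (normal_density 0 (sqrt (1 / 2)) x)
        * ennreal (normal_density 0 (sqrt (1 / 2)) y)) * indicator {z. (norm z)\<^sup>2 \<le> a} z
      = ennreal (1 / pi) * (ennreal (exp (- (norm z)\<^sup>2)) * indicator {z. (norm z)\<^sup>2 \<le> a} z)"
      by (simp only: z prod.case ennreal_mult'[symmetric] mult.assoc[symmetric] normal_density_nonneg)
         (simp add: ennreal_mult'[symmetric])
  qed
  also have "\<dots> = ennreal (1 / pi) * ennreal (pi * (1 - exp (- a)))"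
    by (subst nn_integral_cmult) (simp_all add: nn_integral_exp_neg_norm_sq \<open>0 \<le> a\<close>)
  also have "\<dots> = 1 - ennreal (exp (- a * 1))"
    using \<open>0 \<le> a\<close> by (simp add: ennreal_mult'[symmetric] ennreal_minus ennreal_1[symmetric] del: ennreal_1)
  finally show "emeasure M {\<omega> \<in> space M. (X \<omega>)\<^sup>2 + (Y \<omega>)\<^sup>2 \<le> a} = 1 - ennreal (exp (- a * 1))" .
qed simp

section \<open>Conditioning on independent variables\<close>

text \<open>Independence makes the joint law a product, so the probability is the integral over
  \<open>x\<close> in \<open>B\<close> of the probability of the section of \<open>C\<close> at
  \<open>x\<close>. This replaces conditioning on \<open>X\<close>.\<close>

lemma (in prob_space) indep_var_prob_section_le:
  assumes indep: "indep_var S X T Y" and B: "B \<in> sets S" and C: "C \<in> sets (S \<Otimes>\<^sub>M T)"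
    and le: "\<And>x. x \<in> space S \<Longrightarrow> prob {\<omega> \<in> space M. (x, Y \<omega>) \<in> C} \<le> e"
  shows "prob {\<omega> \<in> space M. X \<omega> \<in> B \<and> (X \<omega>, Y \<omega>) \<in> C} \<le> e * prob {\<omega> \<in> space M. X \<omega> \<in> B}"
proof -
  note [measurable] = indep_var_rv1[OF indep] indep_var_rv2[OF indep] B C
  interpret Y: prob_space "distr M T Y" by (rule prob_space_distr) simp
  \<comment> \<open>A probability space is nonempty, so \<open>S\<close> has a point and
    \<open>le\<close> can be used there to see that \<open>e\<close> is nonnegative.\<close>
  obtain x where "x \<in> space S"
    using not_empty measurable_space[OF indep_var_rv1[OF indep]] by blast
  then have "0 \<le> e" using order_trans[OF measure_nonneg le] by blast
  let ?Q = "(B \<times> space T) \<inter> C"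
  have Q[measurable]: "?Q \<in> sets (S \<Otimes>\<^sub>M T)" by measurable
  have "emeasure M {\<omega> \<in> space M. X \<omega> \<in> B \<and> (X \<omega>, Y \<omega>) \<in> C}
      = emeasure (distr M (S \<Otimes>\<^sub>M T) (\<lambda>\<omega>. (X \<omega>, Y \<omega>))) ?Q"
    using measurable_space[OF indep_var_rv2[OF indep]]
    by (subst emeasure_distr) (auto intro!: arg_cong[where f = "emeasure M"])
  also have "\<dots> = emeasure (distr M S X \<Otimes>\<^sub>M distr M T Y) ?Q"
    using indep by (simp add: indep_var_distribution_eq)
  also have "\<dots> = (\<integral>\<^sup>+x. emeasure (distr M T Y) (Pair x -` ?Q) \<partial>distr M S X)"
    by (intro Y.emeasure_pair_measure_alt) simp
  also have "\<dots> \<le> (\<integral>\<^sup>+x. ennreal e * indicator B x \<partial>distr M S X)"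
  proof (intro nn_integral_mono)
    fix x assume "x \<in> space (distr M S X)"
    then have x: "x \<in> space S" by simp
    show "emeasure (distr M T Y) (Pair x -` ?Q) \<le> ennreal e * indicator B x"
    proof (cases "x \<in> B")
      case True
      have "emeasure (distr M T Y) (Pair x -` ?Q) = emeasure M {\<omega> \<in> space M. (x, Y \<omega>) \<in> C}"
        using True measurable_space[OF indep_var_rv2[OF indep]]
        by (subst emeasure_distr) (auto intro!: arg_cong[where f = "emeasure M"] sets_Pair1 Q simp del: sets_Pair1)
      then show ?thesis
        using le[OF x] True by (simp add: emeasure_eq_measure ennreal_leI)
    qed simp
  qed
  also have "\<dots> = ennreal e * emeasure M {\<omega> \<in> space M. X \<omega> \<in> B}"
    by (simp add: nn_integral_cmult emeasure_distr vimage_def Int_def conj_commute)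
  finally show ?thesis
    using \<open>0 \<le> e\<close> by (simp add: emeasure_eq_measure ennreal_mult'[symmetric])
qed

text \<open>Induction on \<open>J\<close> peels off one variable at a time. Once the other variables
  are fixed, the shift of \<open>V j\<close> is a constant, because it depends only on the variables
  in \<open>I\<close>; each step therefore costs one factor \<open>e\<close>.\<close>

lemma (in prob_space) indep_vars_prob_shifted_le:
  fixes V :: "'i \<Rightarrow> 'a \<Rightarrow> real"
  assumes "finite J" and indep: "indep_vars (\<lambda>_. borel) V (I \<union> J)" and disj: "I \<inter> J = {}"
    and c: "\<And>j. j \<in> J \<Longrightarrow> c j \<in> borel_measurable (\<Pi>\<^sub>M i\<in>I. borel)"
    and le: "\<And>j a. j \<in> J \<Longrightarrow> prob {\<omega> \<in> space M. \<bar>V j \<omega> + a\<bar> < r} \<le> e"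
    and "0 \<le> e" and B: "B \<in> sets (\<Pi>\<^sub>M i\<in>I. borel)"
  shows "prob {\<omega> \<in> space M. (\<lambda>i\<in>I. V i \<omega>) \<in> B \<and> (\<forall>j\<in>J. \<bar>V j \<omega> + c j (\<lambda>i\<in>I. V i \<omega>)\<bar> < r)}
      \<le> e ^ card J * prob {\<omega> \<in> space M. (\<lambda>i\<in>I. V i \<omega>) \<in> B}"
  using \<open>finite J\<close> indep disj c le
proof (induction J rule: finite_induct)
  case empty
  then show ?case by simp
next
  case (insert j J)
  let ?S = "\<Pi>\<^sub>M i\<in>I \<union> J. (borel :: real measure)"
  let ?X = "\<lambda>\<omega>. \<lambda>i\<in>I \<union> J. V i \<omega>"
  let ?T = "\<Pi>\<^sub>M i\<in>{j}. (borel :: real measure)"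
  let ?Y = "\<lambda>\<omega>. \<lambda>i\<in>{j}. V i \<omega>"
  \<comment> \<open>\<open>B'\<close> gathers the constraints left to the induction hypothesis, and
    \<open>C\<close> is the single constraint on the new variable \<open>V j\<close>.\<close>
  define B' where "B' = {f \<in> space ?S. restrict f I \<in> B \<and> (\<forall>k\<in>J. \<bar>f k + c k (restrict f I)\<bar> < r)}"
  define C where "C = {p \<in> space (?S \<Otimes>\<^sub>M ?T). \<bar>snd p j + c j (restrict (fst p) I)\<bar> < r}"
  have [measurable]: "(\<lambda>f. restrict f I) \<in> ?S \<rightarrow>\<^sub>M (\<Pi>\<^sub>M i\<in>I. borel)"
    by (rule measurable_restrict_subset) simp
  have [measurable]: "c k \<in> borel_measurable (\<Pi>\<^sub>M i\<in>I. borel)" if "k \<in> insert j J" for k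
    using insert.prems(3) that .
  note [measurable] = B
  have [measurable]: "(\<lambda>f. f k) \<in> borel_measurable ?S" if "k \<in> J" for k
    using that by (intro measurable_component_singleton) simp
  have [measurable]: "(\<lambda>f. f j) \<in> borel_measurable ?T"
    by (intro measurable_component_singleton) simp
  have B': "B' \<in> sets ?S"
    unfolding B'_def using \<open>finite J\<close> by measurable
  have C: "C \<in> sets (?S \<Otimes>\<^sub>M ?T)"
    unfolding C_def by measurable
  have ind: "indep_var ?S ?X ?T ?Y"
    using insert by (intro indep_var_restrict[OF insert.prems(1)]) auto
  have sp: "?X \<omega> \<in> space ?S" for \<omega>
    by (simp add: space_PiM)
  have restr: "restrict (?X \<omega>) I = (\<lambda>i\<in>I. V i \<omega>)" for \<omega>
    by (auto simp: restrict_def)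
  have "{\<omega> \<in> space M. (\<lambda>i\<in>I. V i \<omega>) \<in> B \<and> (\<forall>k\<in>insert j J. \<bar>V k \<omega> + c k (\<lambda>i\<in>I. V i \<omega>)\<bar> < r)}
      = {\<omega> \<in> space M. ?X \<omega> \<in> B' \<and> (?X \<omega>, ?Y \<omega>) \<in> C}"
    using sp by (auto simp: B'_def C_def restr space_pair_measure space_PiM)
  also have "prob \<dots> \<le> e * prob {\<omega> \<in> space M. ?X \<omega> \<in> B'}"
  proof (rule indep_var_prob_section_le[OF ind B' C])
    fix f assume "f \<in> space ?S"
    then show "prob {\<omega> \<in> space M. (f, ?Y \<omega>) \<in> C} \<le> e"
      using insert.prems(4)[of j "c j (restrict f I)"] by (simp add: C_def space_pair_measure space_PiM)
  qed
  also have "{\<omega> \<in> space M. ?X \<omega> \<in> B'}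
      = {\<omega> \<in> space M. (\<lambda>i\<in>I. V i \<omega>) \<in> B \<and> (\<forall>k\<in>J. \<bar>V k \<omega> + c k (\<lambda>i\<in>I. V i \<omega>)\<bar> < r)}"
    using sp by (auto simp: B'_def restr)
  also have "e * prob \<dots> \<le> e * (e ^ card J * prob {\<omega> \<in> space M. (\<lambda>i\<in>I. V i \<omega>) \<in> B})"
    using insert.prems insert.hyps \<open>0 \<le> e\<close>
    by (intro mult_left_mono insert.IH) (auto intro: indep_vars_subset)
  also have "\<dots> = e ^ card (insert j J) * prob {\<omega> \<in> space M. (\<lambda>i\<in>I. V i \<omega>) \<in> B}"
    using insert.hyps by simp
  finally show ?case .
qed

section \<open>Incomplete gamma function, square and disc, channel gains\<close>

text \<open>Both sides have the same closed form, a finite exponential sum. The Erlang parameter is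
  one less than the number of exponential summands, hence \<open>N - 1\<close>.\<close>

lemma lower_incomplete_gamma_eq_erlang_CDF:
  assumes "0 \<le> a"
  shows "lower_incomplete_gamma N a = fact (N - 1) * erlang_CDF (N - 1) 1 a"
proof -
  have int: "(\<lambda>s::real. s ^ (N - 1) * exp (- s)) integrable_on {0..a}"
    by (intro integrable_continuous_real continuous_intros)
  have nn: "0 \<le> integral {0..a} (\<lambda>s::real. s ^ (N - 1) * exp (- s))"
    by (intro integral_nonneg int) auto
  have "ennreal (integral {0..a} (\<lambda>s. s ^ (N - 1) * exp (- s)))
      = (\<integral>\<^sup>+s. ennreal (s ^ (N - 1) * exp (- s)) * indicator {0..a} s \<partial>lborel)"
    by (rule nn_integral_has_integral_lebesgue'[symmetric]) (use integrable_integral[OF int] in auto)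
  also have "\<dots> = (1 - (\<Sum>n\<le>N - 1. (a ^ n * exp (- a)) / fact n)) * fact (N - 1)"
    by (rule nn_intergal_power_times_exp_Icc) fact
  also have "\<dots> = ennreal (fact (N - 1) * erlang_CDF (N - 1) 1 a)"
    using assms erlang_CDF_nonneg[of 1 "N - 1" a] by (simp add: erlang_CDF_def mult.commute)
  finally show ?thesis
    using nn by (simp add: lower_incomplete_gamma_def)
qed

text \<open>By independence the product is the probability of an open square, which lies in its
  circumscribed disc; the disc has an exact exponential probability.\<close>

lemma (in prob_space) normal_prob_square_le:
  assumes X: "distributed M lborel X (normal_density 0 (sqrt (1 / 2)))"
    and Y: "distributed M lborel Y (normal_density 0 (sqrt (1 / 2)))"
    and indep: "indep_var borel X borel Y"
  shows "prob {\<omega> \<in> space M. \<bar>X \<omega>\<bar> < t} * prob {\<omega> \<in> space M. \<bar>Y \<omega>\<bar> < t} \<le> 1 - exp (- (2 * t\<^sup>2))"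
proof -
  have [measurable]: "X \<in> borel_measurable M" "Y \<in> borel_measurable M"
    using distributed_measurable[OF X] distributed_measurable[OF Y] by simp_all
  let ?A = "{x::real. \<bar>x\<bar> < t}"
  have "prob {\<omega> \<in> space M. \<bar>X \<omega>\<bar> < t} * prob {\<omega> \<in> space M. \<bar>Y \<omega>\<bar> < t}
      = prob (X -` ?A \<inter> space M) * prob (Y -` ?A \<inter> space M)"
    by (simp add: vimage_def Int_def conj_commute)
  also have "\<dots> = prob ((\<lambda>\<omega>. (X \<omega>, Y \<omega>)) -` (?A \<times> ?A) \<inter> space M)"
    by (rule indep_varD[OF indep, symmetric]) simp_all
  also have "\<dots> \<le> prob {\<omega> \<in> space M. (X \<omega>)\<^sup>2 + (Y \<omega>)\<^sup>2 \<le> 2 * t\<^sup>2}"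
  proof (rule finite_measure_mono)
    have sq: "u\<^sup>2 \<le> t\<^sup>2" if "\<bar>u\<bar> < t" for u :: real
      using power_mono[of "\<bar>u\<bar>" t 2] that by simp
    show "(\<lambda>\<omega>. (X \<omega>, Y \<omega>)) -` (?A \<times> ?A) \<inter> space M
        \<subseteq> {\<omega> \<in> space M. (X \<omega>)\<^sup>2 + (Y \<omega>)\<^sup>2 \<le> 2 * t\<^sup>2}"
    proof safe
      fix \<omega> assume "\<bar>X \<omega>\<bar> < t" "\<bar>Y \<omega>\<bar> < t"
      from sq[OF this(1)] sq[OF this(2)] show "(X \<omega>)\<^sup>2 + (Y \<omega>)\<^sup>2 \<le> 2 * t\<^sup>2"
        by linarith
    qed
  qed simp
  also have "\<dots> = 1 - exp (- (2 * t\<^sup>2))"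
    using exponential_distributedD_le[OF sum_squares_normal_exponential[OF assms], of "2 * t\<^sup>2"] by simp
  finally show ?thesis .
qed

lemma (in prob_space) indep_vars_imp_indep_var:
  assumes "indep_vars (\<lambda>_. N) X I" "i \<in> I" "j \<in> I" "i \<noteq> j"
  shows "indep_var N (X i) N (X j)"
proof -
  \<comment> \<open>Independence is first obtained for restrictions to the singletons
    \<open>{i}\<close> and \<open>{j}\<close>; evaluating at the index then recovers the
    variables.\<close>
  have "indep_var (\<Pi>\<^sub>M i\<in>{i}. N) (\<lambda>\<omega>. \<lambda>i\<in>{i}. X i \<omega>) (\<Pi>\<^sub>M i\<in>{j}. N) (\<lambda>\<omega>. \<lambda>i\<in>{j}. X i \<omega>)"
    using assms by (intro indep_var_restrict[OF assms(1)]) auto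
  then have "indep_var N ((\<lambda>f. f i) \<circ> (\<lambda>\<omega>. \<lambda>i\<in>{i}. X i \<omega>)) N ((\<lambda>f. f j) \<circ> (\<lambda>\<omega>. \<lambda>i\<in>{j}. X i \<omega>))"
    by (rule indep_var_compose) (auto intro: measurable_component_singleton)
  then show ?thesis
    by (simp add: comp_def)
qed

text \<open>Pulling \<open>sqrt (1 - \<rho>\<^sup>2)\<close> out of a port
  \<open>m \<noteq> 1\<close> leaves the port's own Gaussian plus a multiple of the shared one, the
  form that the shift bound handles.\<close>

lemma cmod_channel_sq:
  assumes "\<bar>\<rho>\<bar> < 1"
  shows "(cmod (channel \<sigma> \<rho> x y m n \<omega>))\<^sup>2 =
    (if m = 1 then \<sigma>\<^sup>2 * ((x 0 n \<omega>)\<^sup>2 + (y 0 n \<omega>)\<^sup>2)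
     else \<sigma>\<^sup>2 * (1 - \<rho>\<^sup>2) * ((x m n \<omega> + \<rho> / sqrt (1 - \<rho>\<^sup>2) * x 0 n \<omega>)\<^sup>2
        + (y m n \<omega> + \<rho> / sqrt (1 - \<rho>\<^sup>2) * y 0 n \<omega>)\<^sup>2))"
proof -
  define s where "s = sqrt (1 - \<rho>\<^sup>2)"
  have "\<rho>\<^sup>2 < 1"
    using assms by (simp add: abs_square_less_1)
  then have s: "s > 0" "1 - \<rho>\<^sup>2 = s\<^sup>2"
    by (simp_all add: s_def)
  have eq: "\<sigma>\<^sup>2 * s\<^sup>2 * (u + \<rho> / s * v)\<^sup>2 = (\<sigma> * (s * u + \<rho> * v))\<^sup>2" for u v
    using s by (simp add: power_mult_distrib[symmetric] distrib_left mult.assoc)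
  show ?thesis
  proof (cases "m = 1")
    case True
    then show ?thesis
      by (simp add: channel_def cmod_power2 power_mult_distrib distrib_left)
  next
    case False
    then have "(cmod (channel \<sigma> \<rho> x y m n \<omega>))\<^sup>2
        = (\<sigma> * (s * x m n \<omega> + \<rho> * x 0 n \<omega>))\<^sup>2 + (\<sigma> * (s * y m n \<omega> + \<rho> * y 0 n \<omega>))\<^sup>2"
      by (simp add: channel_def cmod_power2 s_def)
    with False show ?thesis
      by (simp only: s_def[symmetric]) (simp only: s(2) distrib_left[of "\<sigma>\<^sup>2 * s\<^sup>2"] eq if_False)
  qed
qed

section \<open>The outage bound\<close>

theorem corollary1:
  fixes P :: "'a measure"
    and N M :: nat
    and \<sigma> \<rho> :: real
    and x y :: "nat \<Rightarrow> nat \<Rightarrow> 'a \<Rightarrow> real"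
  assumes "prob_space P"
    and "N \<ge> 1" and "M \<ge> 1"
    and "\<sigma> > 0" and "\<bar>\<rho>\<bar> < 1"
    and "iid_gaussians P M N x y"
  shows "\<forall>\<gamma>\<^sub>t\<^sub>h > 0.
    P_out P \<sigma> \<rho> M N x y \<gamma>\<^sub>t\<^sub>h
      \<le> 1 / fact (N - 1) * lower_incomplete_gamma N (\<gamma>\<^sub>t\<^sub>h / \<sigma>\<^sup>2)
          * (1 - exp (- (2 * \<gamma>\<^sub>t\<^sub>h / (\<sigma>\<^sup>2 * (1 - \<rho>\<^sup>2))))) ^ (M - 1)"
proof (intro allI impI)
  fix g :: real
  assume "g > 0"
  interpret prob_space P by fact
  have "\<rho>\<^sup>2 < 1"
    using \<open>\<bar>\<rho>\<bar> < 1\<close> by (simp add: abs_square_less_1)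
  define G where "G = gauss_indices M N <+> gauss_indices M N"
  define V where "V = case_sum (\<lambda>(m, n). x m n) (\<lambda>(m, n). y m n)"
  \<comment> \<open>\<open>I\<close> indexes the shared components at all antennas. \<open>J\<close>
    indexes the own components of the ports \<open>m \<ge> 2\<close> at antenna 1 only, two for each
    port.\<close>
  define I where "I = ({0::nat} \<times> {1..N}) <+> ({0::nat} \<times> {1..N})"
  define J where "J = ({2..M} \<times> {1::nat}) <+> ({2..M} \<times> {1::nat})"
  \<comment> \<open>\<open>t\<close> and \<open>k\<close> come from dividing the squared modulus at
    antenna 1 by \<open>\<sigma>\<^sup>2 * (1 - \<rho>\<^sup>2)\<close>: the bound becomes
    \<open>t\<^sup>2\<close>, and \<open>k\<close> multiplies the shared component. The map
    \<open>c\<close> chooses its real or imaginary part.\<close>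
  define t where "t = sqrt (g / (\<sigma>\<^sup>2 * (1 - \<rho>\<^sup>2)))"
  define k where "k = \<rho> / sqrt (1 - \<rho>\<^sup>2)"
  define c :: "nat \<times> nat + nat \<times> nat \<Rightarrow> (nat \<times> nat + nat \<times> nat \<Rightarrow> real) \<Rightarrow> real"
    where "c = case_sum (\<lambda>_ f. k * f (Inl (0, 1))) (\<lambda>_ f. k * f (Inr (0, 1)))"
  define Q where "Q f = (\<Sum>n=1..N. (f (Inl (0, n)))\<^sup>2 + (f (Inr (0, n)))\<^sup>2)"
    for f :: "nat \<times> nat + nat \<times> nat \<Rightarrow> real"
  define B where "B = {f \<in> space (\<Pi>\<^sub>M i\<in>I. borel). Q f \<le> g / \<sigma>\<^sup>2}"
  define e where "e = prob {\<omega> \<in> space P. \<bar>x 0 1 \<omega>\<bar> < t}"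

  have indep: "indep_vars (\<lambda>_. borel) V G"
    using assms(6) by (simp add: iid_gaussians_def V_def G_def)
  have normal: "distributed P lborel (V i) (normal_density 0 (sqrt (1 / 2)))" if "i \<in> G" for i
    using assms(6) that by (auto simp: iid_gaussians_def V_def G_def split: sum.split)
  have IJ: "I \<union> J \<subseteq> G" "I \<inter> J = {}" "finite J" "card J = 2 * (M - 1)"
    using \<open>N \<ge> 1\<close> by (auto simp: I_def J_def G_def gauss_indices_def card_Plus)
  have in_G: "Inl (0, n) \<in> G" "Inr (0, n) \<in> G" if "n \<in> {1..N}" for n
    using that by (auto simp: G_def gauss_indices_def)
  have comp [measurable]: "(\<lambda>f. f (Inl (0, n))) \<in> borel_measurable (\<Pi>\<^sub>M i\<in>I. borel)"
    "(\<lambda>f. f (Inr (0, n))) \<in> borel_measurable (\<Pi>\<^sub>M i\<in>I. borel)" if "n \<in> {1..N}" for n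
    using that by (auto intro!: measurable_component_singleton simp: I_def)
  have V0: "V (Inl (m, n)) = x m n" "V (Inr (m, n)) = y m n" for m n
    by (simp_all add: V_def)

  have same: "prob {\<omega> \<in> space P. \<bar>V i \<omega>\<bar> < t} = e" if "i \<in> G" for i
  proof -
    have "emeasure P (V i' -` {u. \<bar>u\<bar> < t} \<inter> space P)
        = (\<integral>\<^sup>+u. ennreal (normal_density 0 (sqrt (1 / 2)) u) * indicator {u. \<bar>u\<bar> < t} u \<partial>lborel)"
      if "i' \<in> G" for i'
      by (rule distributed_emeasure[OF normal[OF that]]) simp
    from this[OF that] this[OF in_G(1)[of 1]] show ?thesis
      using \<open>N \<ge> 1\<close> by (simp add: e_def V0 measure_def vimage_def Int_def conj_commute)
  qed
  \<comment> \<open>The real and imaginary components of one port contribute two factors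
    \<open>e\<close>; together they form the square that is compared with the disc.\<close>
  have "e * e \<le> 1 - exp (- (2 * t\<^sup>2))"
  proof -
    have "indep_var borel (V (Inl (0, 1))) borel (V (Inr (0, 1)))"
      using \<open>N \<ge> 1\<close> by (intro indep_vars_imp_indep_var[OF indep] in_G) auto
    from normal_prob_square_le[OF normal normal this, of t] show ?thesis
      using \<open>N \<ge> 1\<close> in_G[of 1] by (simp add: same)
  qed
  also have "2 * t\<^sup>2 = 2 * g / (\<sigma>\<^sup>2 * (1 - \<rho>\<^sup>2))"
    using \<open>g > 0\<close> \<open>\<rho>\<^sup>2 < 1\<close> by (simp add: t_def)
  finally have e2: "e * e \<le> 1 - exp (- (2 * g / (\<sigma>\<^sup>2 * (1 - \<rho>\<^sup>2))))" .

  have "distributed P lborel (\<lambda>\<omega>. \<Sum>n=1..N. (x 0 n \<omega>)\<^sup>2 + (y 0 n \<omega>)\<^sup>2) (erlang_density (card {1..N} - 1) 1)"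
  proof (rule exponential_distributed_sum)
    show "distributed P lborel (\<lambda>\<omega>. (x 0 n \<omega>)\<^sup>2 + (y 0 n \<omega>)\<^sup>2) (exponential_density 1)" if "n \<in> {1..N}" for n
      using sum_squares_normal_exponential[OF normal normal indep_vars_imp_indep_var[OF indep], OF in_G[OF that] in_G[OF that]]
      by (simp add: V0)
    \<comment> \<open>Antenna \<open>n\<close> uses the pair \<open>?K n\<close>; these blocks are
      disjoint, so functions of different blocks are independent.\<close>
    let ?K = "\<lambda>n. {Inl (0, n), Inr (0, n)} :: (nat \<times> nat + nat \<times> nat) set"
    have "indep_vars (\<lambda>n. \<Pi>\<^sub>M i\<in>?K n. borel) (\<lambda>n \<omega>. \<lambda>i\<in>?K n. V i \<omega>) {1..N}"
      by (rule indep_vars_restrict[OF indep]) (use in_G in \<open>auto simp: disjoint_family_on_def\<close>)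
    from indep_vars_compose2[OF this, where Y = "\<lambda>n f. (f (Inl (0, n)))\<^sup>2 + (f (Inr (0, n)))\<^sup>2" and N = "\<lambda>_. borel"]
    show "indep_vars (\<lambda>_. borel) (\<lambda>n \<omega>. (x 0 n \<omega>)\<^sup>2 + (y 0 n \<omega>)\<^sup>2) {1..N}"
      by (simp add: V0 measurable_component_singleton)
  qed (use \<open>N \<ge> 1\<close> in auto)
  from erlang_distributed_le[OF this, of "g / \<sigma>\<^sup>2"]
  have CDF: "prob {\<omega> \<in> space P. (\<Sum>n=1..N. (x 0 n \<omega>)\<^sup>2 + (y 0 n \<omega>)\<^sup>2) \<le> g / \<sigma>\<^sup>2} = erlang_CDF (N - 1) 1 (g / \<sigma>\<^sup>2)"
    using \<open>g > 0\<close> by simp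

  have Q_V: "Q (\<lambda>i\<in>I. V i \<omega>) = (\<Sum>n=1..N. (x 0 n \<omega>)\<^sup>2 + (y 0 n \<omega>)\<^sup>2)" for \<omega>
    unfolding Q_def by (intro sum.cong) (auto simp: I_def V0)
  have V_B: "(\<lambda>i\<in>I. V i \<omega>) \<in> B \<longleftrightarrow> (\<Sum>n=1..N. (x 0 n \<omega>)\<^sup>2 + (y 0 n \<omega>)\<^sup>2) \<le> g / \<sigma>\<^sup>2" for \<omega>
    by (simp add: B_def Q_V space_PiM)
  have B: "B \<in> sets (\<Pi>\<^sub>M i\<in>I. borel)"
    unfolding B_def Q_def by measurable
  let ?E = "{\<omega> \<in> space P. (\<lambda>i\<in>I. V i \<omega>) \<in> B \<and> (\<forall>j\<in>J. \<bar>V j \<omega> + c j (\<lambda>i\<in>I. V i \<omega>)\<bar> < t)}"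
  have c: "c j \<in> borel_measurable (\<Pi>\<^sub>M i\<in>I. borel)" if "j \<in> J" for j
    using \<open>N \<ge> 1\<close> comp[of 1] by (auto simp: c_def split: sum.split)
  have "P_out P \<sigma> \<rho> M N x y g \<le> prob ?E"
    unfolding P_out_def
  proof (rule finite_measure_mono)
    \<comment> \<open>Port 1 gives membership in \<open>B\<close>, where the strict bound is relaxed
      to a weak one. Every other port gives two interval constraints, from its antenna 1 alone,
      since the remaining terms of its gain are nonnegative.\<close>
    show "{\<omega> \<in> space P. X_FAS \<sigma> \<rho> M N x y \<omega> < g} \<subseteq> ?E"
    proof safe
      fix \<omega> assume "X_FAS \<sigma> \<rho> M N x y \<omega> < g"
      then have gain: "port_gain \<sigma> \<rho> N x y m \<omega> < g" if "m \<in> {1..M}" for m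
        using that by (auto simp: X_FAS_def)
      have "\<sigma>\<^sup>2 * (\<Sum>n=1..N. (x 0 n \<omega>)\<^sup>2 + (y 0 n \<omega>)\<^sup>2) < g"
        using gain[of 1] \<open>M \<ge> 1\<close> by (simp add: port_gain_def cmod_channel_sq[OF \<open>\<bar>\<rho>\<bar> < 1\<close>] sum_distrib_left)
      then show "(\<lambda>i\<in>I. V i \<omega>) \<in> B"
        using \<open>\<sigma> > 0\<close> by (simp add: V_B field_simps)
      fix j assume "j \<in> J"
      then obtain m where m: "m \<in> {2..M}" "j = Inl (m, 1) \<or> j = Inr (m, 1)"
        by (auto simp: J_def)
      let ?u = "x m 1 \<omega> + k * x 0 1 \<omega>" and ?v = "y m 1 \<omega> + k * y 0 1 \<omega>"
      have "\<sigma>\<^sup>2 * (1 - \<rho>\<^sup>2) * (?u\<^sup>2 + ?v\<^sup>2) = (cmod (channel \<sigma> \<rho> x y m 1 \<omega>))\<^sup>2"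
        using m by (simp add: cmod_channel_sq[OF \<open>\<bar>\<rho>\<bar> < 1\<close>] k_def)
      also have "\<dots> \<le> port_gain \<sigma> \<rho> N x y m \<omega>"
        unfolding port_gain_def using \<open>N \<ge> 1\<close> by (intro member_le_sum) auto
      also have "\<dots> < g"
        using gain[of m] m by simp
      finally have "?u\<^sup>2 + ?v\<^sup>2 < g / (\<sigma>\<^sup>2 * (1 - \<rho>\<^sup>2))"
        using \<open>\<sigma> > 0\<close> \<open>\<rho>\<^sup>2 < 1\<close> by (simp add: pos_less_divide_eq mult.commute)
      then have "?u\<^sup>2 < g / (\<sigma>\<^sup>2 * (1 - \<rho>\<^sup>2))" "?v\<^sup>2 < g / (\<sigma>\<^sup>2 * (1 - \<rho>\<^sup>2))"
        using zero_le_power2[of ?u] zero_le_power2[of ?v] by linarith+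
      then have "\<bar>?u\<bar> < t" "\<bar>?v\<bar> < t"
        unfolding t_def by (auto simp: real_sqrt_abs[symmetric] simp del: real_sqrt_abs)
      moreover have "Inl (0, 1) \<in> I" "Inr (0, 1) \<in> I"
        using \<open>N \<ge> 1\<close> by (auto simp: I_def)
      ultimately show "\<bar>V j \<omega> + c j (\<lambda>i\<in>I. V i \<omega>)\<bar> < t"
        using m(2) by (auto simp: c_def V0)
    qed
    have [measurable]: "V i \<in> borel_measurable P" if "i \<in> I \<union> J" for i
      using distributed_measurable[OF normal[of i]] that IJ(1) by auto
    have [measurable]: "(\<lambda>\<omega>. \<lambda>i\<in>I. V i \<omega>) \<in> P \<rightarrow>\<^sub>M (\<Pi>\<^sub>M i\<in>I. borel)"
      by (intro measurable_restrict) simp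
    note [measurable] = B c
    show "?E \<in> events"
      using \<open>finite J\<close> by measurable
  qed
  also have "\<dots> \<le> e ^ card J * prob {\<omega> \<in> space P. (\<lambda>i\<in>I. V i \<omega>) \<in> B}"
  proof (rule indep_vars_prob_shifted_le)
    show "indep_vars (\<lambda>_. borel) V (I \<union> J)"
      by (rule indep_vars_subset[OF indep IJ(1)])
    show "prob {\<omega> \<in> space P. \<bar>V j \<omega> + a\<bar> < t} \<le> e" if "j \<in> J" for j a
      using normal_prob_shifted_interval_le[OF normal, of j a t] same[of j] that IJ(1) by auto
  qed (use IJ B c in \<open>auto simp: e_def\<close>)
  \<comment> \<open>As \<open>J\<close> has \<open>2 * (M - 1)\<close> elements, the power of
    \<open>e\<close> regroups into one factor \<open>e * e\<close> for each port
    \<open>m \<ge> 2\<close>.\<close>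
  also have "\<dots> = (e * e) ^ (M - 1) * erlang_CDF (N - 1) 1 (g / \<sigma>\<^sup>2)"
    by (simp only: IJ(4) V_B CDF power_mult power2_eq_square[of e])
  also have "\<dots> \<le> (1 - exp (- (2 * g / (\<sigma>\<^sup>2 * (1 - \<rho>\<^sup>2))))) ^ (M - 1) * erlang_CDF (N - 1) 1 (g / \<sigma>\<^sup>2)"
    by (intro mult_right_mono power_mono e2) (auto simp: e_def)
  finally show "P_out P \<sigma> \<rho> M N x y g
      \<le> 1 / fact (N - 1) * lower_incomplete_gamma N (g / \<sigma>\<^sup>2)
          * (1 - exp (- (2 * g / (\<sigma>\<^sup>2 * (1 - \<rho>\<^sup>2))))) ^ (M - 1)"
    using \<open>g > 0\<close> by (simp add: lower_incomplete_gamma_eq_erlang_CDF mult.commute)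
qed

end
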